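(* Let $n\in\mathbb{Z}_{\ge 0}$, $T>0$ and $U=\{0,\ldots,n\}\times[0,T]$. (i) Let $f:\{-1,0,\ldots,n+1\}\times[0,T]\to\mathbb{R}^2$ be a semi-discrete framework and let $(\lambda,\mu)$ be a self-stress for $f$. Then the semi-discrete lifting $L:U\to\mathbb{R}^2\times\mathbb{R}$ of the self-stressed framework $f$ is a semi-discrete conjugate surface in $\mathbb{R}^3$. (ii) Let $F=(f,z):\{-1,0,\ldots,n+1\}\times[0,T]\to\mathbb{R}^2\times\mathbb{R}=\mathbb{R}^3$ be a semi-discrete conjugate surface whose orthogonal projection $f$ to the plane $\mathbb{R}^2$ is regular. Then $f$ is a stressable framework. More precisely, the functions $$\lambda_i=\frac{\det(\Delta f_{i-1},\Delta f_i)\,\dot z_i}{\det(\Delta f_i,\dot f_i)\det(\Delta f_{i-1},\dot f_i)}+\frac{\Delta z_{i-1}}{\det(\Delta f_{i-1},\dot f_i)}-\frac{\Delta z_i}{\det(\Delta f_i,\dot f_i)}\qquad(0\le i\le n)$$ and $$\mu_i=\frac{\det(\Delta f_i,\ddot f_i)\,\dot z_i-\det(\Delta f_i,\dot f_i)\,\ddot z_i-\det(\dot f_i,\ddot f_i)\,\Delta z_i}{\det(\Delta f_i,\dot f_i)^2}\qquad(-1\le i\le n)$$ (all evaluated at the parameter $t\in[0,T]$) form a self-stress $(\lambda,\mu)$ for $f$.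
   Context: Semi-discrete surfaces. A semi-discrete surface in $\mathbb{R}^d$ is a map $F:\{m,m+1,\ldots,M\}\times[0,T]\to\mathbb{R}^d$, $(i,t)\mapsto F_i(t)=F(i,t)$, whose curves $F_i$ are smooth. Write $\dot F_i=\partial F_i/\partial t$ and $\Delta F_i=F_{i+1}-F_i$ (same notation for real-valued functions such as $z_i$). It is regular if for all $i$ and $t$ the pairs $(\dot F_i(t),\Delta F_i(t))$ and $(\dot F_i(t),\Delta F_{i-1}(t))$ are linearly independent (whenever the indices make sense). All semi-discrete surfaces are assumed regular. Conjugate. A semi-discrete surface is conjugate if for each $i$ the ruled surface $(u,v)\mapsto(1+i-u)F_i(v)+(u-i)F_{i+1}(v)$, $u\in[i,i+1)$, $v\in[0,T]$, is developable; equivalently, $\Delta F_i(t),\dot F_i(t),\dot F_{i+1}(t)$ are linearly dependent for all $i$ and $t$. Frameworks and stresses. A (semi-discrete) framework is a regular planar semi-discrete surface $f:\{-1,0,\ldots,n+1\}\times[0,T]\to\mathbb{R}^2$. A stress on $f$ is a pair $(\lambda,\mu)$ of functions $\lambda:\{0,\ldots,n\}\times[0,T]\to\mathbb{R}$ and $\mu:\{-1,0,\ldots,n\}\times[0,T]\to\mathbb{R}$ (with $\lambda_i$ continuously differentiable and $\mu_i$ continuous in $t$). It is a self-stress for $f$ if $$\dot\lambda_i\dot f_i+\lambda_i\ddot f_i+\mu_i\Delta f_i-\mu_{i-1}\Delta f_{i-1}=0\quad\text{for all }(i,t)\in\{0,\ldots,n\}\times[0,T].$$ If a self-stress exists, $f$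 is called stressable. Here $\det(a,b)$ is the determinant of the $2\times2$ matrix with columns $a,b\in\mathbb{R}^2$. Height function and lifting. For $p=(k,s)\in U$, an increasing semi-discrete path to $p$ is a sequence $\gamma=(\gamma_i)_{i=0}^{k+1}$ with $0=\gamma_0\le\gamma_1\le\ldots\le\gamma_{k+1}=s$. The height function is $$H_\gamma(f(p))=\sum_{i=0}^{k-1}\lambda_i(\gamma_{i+1})\det\big(\dot f_i(\gamma_{i+1}),f(p)-f_i(\gamma_{i+1})\big)-\sum_{i=0}^{k}\int_{\gamma_i}^{\gamma_{i+1}}\mu_{i-1}(u)\det\big(\Delta f_{i-1}(u),f(p)-f_{i-1}(u)\big)\,du .$$ (The notation $H_\gamma(f(p))$ stands for a number depending on $p\in U$ and $\gamma$.) If $(\lambda,\mu)$ is a self-stress, this value does not depend on the choice of $\gamma$, and the semi-discrete lifting of $f$ is $L:U\to\mathbb{R}^2\times\mathbb{R}$, $L(p)=(f(p),H_\gamma(f(p)))$, with any increasing semi-discrete path $\gamma$ to $p$.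
   Formalization: "Smooth" is read as class C^r for any 2 ≤ r ≤ ∞, and in (i) λ_i is assumed C^{r-1} and μ_i C^{r-2} (automatic for r = 2), since with only C^1/C^0 stresses the lifting of a smooth framework is in general only C^2. *)

theory Defs
  imports "HOL-Analysis.Analysis" "HOL-Library.Extended_Nat"
begin

text \<open>
  A map \<open>{m,...,M} \<times> [0,T] \<rightarrow> R^d\<close> is rendered as \<open>F :: int \<Rightarrow> real \<Rightarrow> 'a\<close>; only its values
  \<open>F i t\<close> with \<open>i \<in> {m..M}\<close> and \<open>t \<in> {0..T}\<close> are ever used.  Three-space is \<open>real^2 \<times> real\<close>.
  Derivatives in \<open>t\<close> are taken within \<open>[0,T]\<close>, hence one-sided at the end points.
\<close>

definition curve_deriv :: "real \<Rightarrow> (real \<Rightarrow> 'a::real_normed_vector) \<Rightarrow> real \<Rightarrow> 'a" where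
  "curve_deriv T c t = vector_derivative c (at t within {0..T})"

definition diff :: "(int \<Rightarrow> real \<Rightarrow> 'a::real_normed_vector) \<Rightarrow> int \<Rightarrow> real \<Rightarrow> 'a" where
  "diff F i t = F (i + 1) t - F i t"

text \<open>\<open>c\<close> is of class \<open>C^r\<close> on \<open>[0,T]\<close>, where \<open>r = \<infinity>\<close> is allowed.\<close>

definition C_class :: "enat \<Rightarrow> real \<Rightarrow> (real \<Rightarrow> 'a::real_normed_vector) \<Rightarrow> bool" where
  "C_class r T c \<longleftrightarrow>
     (\<forall>k::nat. enat k \<le> r \<longrightarrow> continuous_on {0..T} ((curve_deriv T ^^ k) c)) \<and>
     (\<forall>k::nat. enat k < r \<longrightarrow> (curve_deriv T ^^ k) c differentiable_on {0..T})"

text \<open>Linear independence of a family of vectors, so that repetitions count as dependence.\<close>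

definition lin_indep :: "'a::real_vector list \<Rightarrow> bool" where
  "lin_indep vs \<longleftrightarrow> distinct vs \<and> independent (set vs)"

definition regular :: "int \<Rightarrow> int \<Rightarrow> real \<Rightarrow> (int \<Rightarrow> real \<Rightarrow> 'a::real_normed_vector) \<Rightarrow> bool" where
  "regular m M T F \<longleftrightarrow>
     (\<forall>i\<in>{m..M}. \<forall>t\<in>{0..T}.
        (i < M \<longrightarrow> lin_indep [curve_deriv T (F i) t, diff F i t]) \<and>
        (m < i \<longrightarrow> lin_indep [curve_deriv T (F i) t, diff F (i - 1) t]))"

text \<open>
  The smoothness class \<open>r\<close> of the curves is a parameter, with \<open>2 \<le> r \<le> \<infinity>\<close> in the applications.
  It matters for liftings: a stress is only \<open>C^1\<close> in \<open>lam\<close> and \<open>C^0\<close> in \<open>mu\<close>, and the second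
  derivative of the lifted height contains the summand \<open>- mu (i - 1) * det (diff f (i - 1), f' i)\<close>.
  So a lifting is \<open>C^2\<close> in general, and it is \<open>C^r\<close> if in addition \<open>lam\<close> is \<open>C^(r-1)\<close> and
  \<open>mu\<close> is \<open>C^(r-2)\<close>; for \<open>r = 2\<close> this is no restriction on the stress.
  Every semi-discrete surface is regular by convention.
\<close>

definition semi_discrete_surface ::
    "enat \<Rightarrow> int \<Rightarrow> int \<Rightarrow> real \<Rightarrow> (int \<Rightarrow> real \<Rightarrow> 'a::real_normed_vector) \<Rightarrow> bool" where
  "semi_discrete_surface r m M T F \<longleftrightarrow> (\<forall>i\<in>{m..M}. C_class r T (F i)) \<and> regular m M T F"

definition ruled_surface ::
    "(int \<Rightarrow> real \<Rightarrow> 'a::real_normed_vector) \<Rightarrow> int \<Rightarrow> real \<Rightarrow> real \<Rightarrow> 'a" where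
  "ruled_surface F i u v = (1 + of_int i - u) *\<^sub>R F i v + (u - of_int i) *\<^sub>R F (i + 1) v"

text \<open>
  A parametrised ruled surface \<open>X\<close> with rulings \<open>v = const\<close> is developable if along each
  ruling it has one and the same tangent plane \<open>W\<close>.  (At singular points of \<open>X\<close> the partial
  derivatives span less than a plane, and are only required to lie in \<open>W\<close>.)
\<close>

definition developable ::
    "real set \<Rightarrow> real set \<Rightarrow> (real \<Rightarrow> real \<Rightarrow> 'a::real_normed_vector) \<Rightarrow> bool" where
  "developable I J X \<longleftrightarrow>
     (\<forall>v\<in>J. \<exists>W. subspace W \<and> dim W = 2 \<and>
        (\<forall>u\<in>I. vector_derivative (\<lambda>x. X x v) (at u within I) \<in> W \<and>
                vector_derivative (\<lambda>y. X u y) (at v within J) \<in> W))"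

definition conjugate_surface ::
    "enat \<Rightarrow> int \<Rightarrow> int \<Rightarrow> real \<Rightarrow> (int \<Rightarrow> real \<Rightarrow> 'a::real_normed_vector) \<Rightarrow> bool" where
  "conjugate_surface r m M T F \<longleftrightarrow>
     semi_discrete_surface r m M T F \<and>
     (\<forall>i\<in>{m..<M}. developable {of_int i..<of_int i + 1} {0..T} (ruled_surface F i))"

definition framework :: "enat \<Rightarrow> nat \<Rightarrow> real \<Rightarrow> (int \<Rightarrow> real \<Rightarrow> real^2) \<Rightarrow> bool" where
  "framework r n T f \<longleftrightarrow> semi_discrete_surface r (-1) (int n + 1) T f"

definition stress :: "nat \<Rightarrow> real \<Rightarrow> (int \<Rightarrow> real \<Rightarrow> real) \<Rightarrow> (int \<Rightarrow> real \<Rightarrow> real) \<Rightarrow> bool" where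
  "stress n T lam mu \<longleftrightarrow>
     (\<forall>i\<in>{0..int n}. C_class 1 T (lam i)) \<and> (\<forall>i\<in>{-1..int n}. continuous_on {0..T} (mu i))"

definition self_stress ::
    "nat \<Rightarrow> real \<Rightarrow> (int \<Rightarrow> real \<Rightarrow> real^2) \<Rightarrow> (int \<Rightarrow> real \<Rightarrow> real) \<Rightarrow> (int \<Rightarrow> real \<Rightarrow> real) \<Rightarrow> bool"
  where
  "self_stress n T f lam mu \<longleftrightarrow> stress n T lam mu \<and>
     (\<forall>i\<in>{0..int n}. \<forall>t\<in>{0..T}.
        curve_deriv T (lam i) t *\<^sub>R curve_deriv T (f i) t
        + lam i t *\<^sub>R curve_deriv T (curve_deriv T (f i)) t
        + mu i t *\<^sub>R diff f i t - mu (i - 1) t *\<^sub>R diff f (i - 1) t = 0)"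

definition stressable :: "nat \<Rightarrow> real \<Rightarrow> (int \<Rightarrow> real \<Rightarrow> real^2) \<Rightarrow> bool" where
  "stressable n T f \<longleftrightarrow> (\<exists>lam mu. self_stress n T f lam mu)"

definition det2 :: "real^2 \<Rightarrow> real^2 \<Rightarrow> real" where
  "det2 a b = det (transpose (vector [a, b] :: real^2^2))"

definition increasing_path :: "int \<Rightarrow> real \<Rightarrow> (int \<Rightarrow> real) \<Rightarrow> bool" where
  "increasing_path k s \<gamma> \<longleftrightarrow>
     \<gamma> 0 = 0 \<and> (\<forall>i\<in>{0..k}. \<gamma> i \<le> \<gamma> (i + 1)) \<and> \<gamma> (k + 1) = s"

text \<open>The number \<open>H_\<gamma>(f(p))\<close> for \<open>p = (k,s)\<close>.\<close>

definition height ::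
    "real \<Rightarrow> (int \<Rightarrow> real \<Rightarrow> real^2) \<Rightarrow> (int \<Rightarrow> real \<Rightarrow> real) \<Rightarrow> (int \<Rightarrow> real \<Rightarrow> real) \<Rightarrow>
     (int \<Rightarrow> real) \<Rightarrow> int \<Rightarrow> real \<Rightarrow> real" where
  "height T f lam mu \<gamma> k s =
     (\<Sum>i = 0..k - 1. lam i (\<gamma> (i + 1)) *
        det2 (curve_deriv T (f i) (\<gamma> (i + 1))) (f k s - f i (\<gamma> (i + 1))))
     - (\<Sum>i = 0..k. integral {\<gamma> i..\<gamma> (i + 1)}
          (\<lambda>u. mu (i - 1) u * det2 (diff f (i - 1) u) (f k s - f (i - 1) u)))"

text \<open>
  \<open>L\<close> arises by evaluating the height function at each point of \<open>U\<close> along some increasing path,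
  possibly a different one for every point.  A statement about all such \<open>L\<close> is thus a statement
  about any choice of paths; for a self-stress there is exactly one such \<open>L\<close> on \<open>U\<close>.
\<close>

definition semi_discrete_lifting ::
    "nat \<Rightarrow> real \<Rightarrow> (int \<Rightarrow> real \<Rightarrow> real^2) \<Rightarrow> (int \<Rightarrow> real \<Rightarrow> real) \<Rightarrow> (int \<Rightarrow> real \<Rightarrow> real) \<Rightarrow>
     (int \<Rightarrow> real \<Rightarrow> (real^2) \<times> real) \<Rightarrow> bool" where
  "semi_discrete_lifting n T f lam mu L \<longleftrightarrow>
     (\<forall>k\<in>{0..int n}. \<forall>s\<in>{0..T}. \<exists>\<gamma>. increasing_path k s \<gamma> \<and>
        L k s = (f k s, height T f lam mu \<gamma> k s))"

definition induced_lam ::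
    "real \<Rightarrow> (int \<Rightarrow> real \<Rightarrow> real^2) \<Rightarrow> (int \<Rightarrow> real \<Rightarrow> real) \<Rightarrow> int \<Rightarrow> real \<Rightarrow> real" where
  "induced_lam T f z i t =
     det2 (diff f (i - 1) t) (diff f i t) * curve_deriv T (z i) t /
       (det2 (diff f i t) (curve_deriv T (f i) t) * det2 (diff f (i - 1) t) (curve_deriv T (f i) t))
     + diff z (i - 1) t / det2 (diff f (i - 1) t) (curve_deriv T (f i) t)
     - diff z i t / det2 (diff f i t) (curve_deriv T (f i) t)"

definition induced_mu ::
    "real \<Rightarrow> (int \<Rightarrow> real \<Rightarrow> real^2) \<Rightarrow> (int \<Rightarrow> real \<Rightarrow> real) \<Rightarrow> int \<Rightarrow> real \<Rightarrow> real" where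
  "induced_mu T f z i t =
     (det2 (diff f i t) (curve_deriv T (curve_deriv T (f i)) t) * curve_deriv T (z i) t
      - det2 (diff f i t) (curve_deriv T (f i) t) * curve_deriv T (curve_deriv T (z i)) t
      - det2 (curve_deriv T (f i) t) (curve_deriv T (curve_deriv T (f i)) t) * diff z i t)
     / (det2 (diff f i t) (curve_deriv T (f i) t))\<^sup>2"

lemma det2_eq: "det2 a b = a $ 1 * b $ 2 - a $ 2 * b $ 1"
  by (simp add: det2_def det_2 transpose_def vector_2)

lemma increasing_path_exists:
  assumes "0 \<le> k" "0 \<le> s"
  shows "increasing_path k s (\<lambda>i. if i \<le> 0 then 0 else s)"
  using assms by (simp add: increasing_path_def)

lemma C_class_1_iff:
  "C_class 1 T c \<longleftrightarrow> c differentiable_on {0..T} \<and> continuous_on {0..T} (curve_deriv T c)"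
  (is "?L \<longleftrightarrow> ?R")
proof
  assume L: ?L
  have "(curve_deriv T ^^ 0) c differentiable_on {0..T}"
    using L unfolding C_class_def one_enat_def by (metis enat_ord_simps(2) zero_less_one)
  moreover have "continuous_on {0..T} ((curve_deriv T ^^ 1) c)"
    using L unfolding C_class_def one_enat_def by blast
  ultimately show ?R by simp
next
  assume R: ?R
  show ?L unfolding C_class_def one_enat_def
    using R by (auto simp: le_Suc_eq differentiable_imp_continuous_on)
qed

lemma ruled_surface_deriv_ruling:
  assumes "u \<in> {of_int i..<of_int i + 1}"
  shows "vector_derivative (\<lambda>x. ruled_surface F i x v) (at u within {of_int i..<of_int i + 1})
         = diff F i v"
proof (rule vector_derivative_within)
  have "u islimpt {u..<of_int i + 1}"
    using assms by (simp add: islimpt_Ico)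
  then have "u islimpt {of_int i..<of_int i + 1::real}"
    by (rule islimpt_subset) (use assms in auto)
  then show "at u within {of_int i..<of_int i + 1::real} \<noteq> bot"
    by (simp add: trivial_limit_within)
  show "((\<lambda>x. ruled_surface F i x v) has_vector_derivative diff F i v)
        (at u within {of_int i..<of_int i + 1})"
    unfolding ruled_surface_def diff_def
    by (auto intro!: derivative_eq_intros)
qed

lemma C_class_has_deriv:
  assumes "C_class r T c" "1 \<le> r" "t \<in> {0..T}"
  shows "(c has_vector_derivative curve_deriv T c t) (at t within {0..T})"
proof -
  have "enat 0 < r" using assms(2)
    by (metis i0_lb less_le_trans one_enat_def order_less_le zero_enat_def zero_neq_one)
  then have "(curve_deriv T ^^ 0) c differentiable_on {0..T}"
    using assms(1) unfolding C_class_def by blast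
  then have "c differentiable (at t within {0..T})"
    using assms(3) by (simp add: differentiable_on_def)
  then show ?thesis
    unfolding curve_deriv_def by (simp add: vector_derivative_works)
qed

lemma ruled_surface_deriv_curve:
  assumes "C_class r T (F i)" "C_class r T (F (i + 1))" "1 \<le> r" "0 < T" "v \<in> {0..T}"
  shows "vector_derivative (\<lambda>y. ruled_surface F i u y) (at v within {0..T})
         = (1 + of_int i - u) *\<^sub>R curve_deriv T (F i) v
           + (u - of_int i) *\<^sub>R curve_deriv T (F (i + 1)) v"
proof (rule vector_derivative_within)
  show "at v within {0..T} \<noteq> bot"
    using assms by (simp add: trivial_limit_within islimpt_Icc)
  show "((\<lambda>y. ruled_surface F i u y) has_vector_derivative
        (1 + of_int i - u) *\<^sub>R curve_deriv T (F i) v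
           + (u - of_int i) *\<^sub>R curve_deriv T (F (i + 1)) v) (at v within {0..T})"
    unfolding ruled_surface_def
    using C_class_has_deriv[OF assms(1,3,5)] C_class_has_deriv[OF assms(2,3,5)]
    by (auto intro!: derivative_eq_intros)
qed

text \<open>Conjugacy in terms of linear dependence of three vectors.\<close>

lemma conjugate_surface_iff:
  fixes F :: "int \<Rightarrow> real \<Rightarrow> 'a::euclidean_space"
  assumes "semi_discrete_surface r m M T F" "1 \<le> r" "0 < T"
  shows "conjugate_surface r m M T F \<longleftrightarrow>
     (\<forall>i\<in>{m..<M}. \<forall>t\<in>{0..T}.
        \<not> lin_indep [diff F i t, curve_deriv T (F i) t, curve_deriv T (F (i + 1)) t])"
proof -
  have "developable {of_int i..<of_int i + 1} {0..T} (ruled_surface F i) \<longleftrightarrow>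
        (\<forall>t\<in>{0..T}. \<not> lin_indep [diff F i t, curve_deriv T (F i) t, curve_deriv T (F (i + 1)) t])"
    if i: "i \<in> {m..<M}" for i
  proof -
    have C: "C_class r T (F i)" "C_class r T (F (i + 1))"
      using assms(1) i by (auto simp: semi_discrete_surface_def)
    show ?thesis unfolding developable_def
    proof (intro ball_cong refl)
      fix t assume t: "t \<in> {0..T}"
      let ?I = "{of_int i..<of_int i + 1::real}"
      let ?a = "diff F i t" and ?b = "curve_deriv T (F i) t" and ?c = "curve_deriv T (F (i + 1)) t"
      have ind: "?b \<noteq> ?a" "independent {?b, ?a}"
        using assms(1) i t by (auto simp: semi_discrete_surface_def regular_def lin_indep_def)
      have ind': "independent {?a, ?b}" using ind by (simp add: insert_commute)
      show "(\<exists>W. subspace W \<and> dim W = 2 \<and>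
          (\<forall>u\<in>?I. vector_derivative (\<lambda>x. ruled_surface F i x t) (at u within ?I) \<in> W \<and>
                  vector_derivative (\<lambda>y. ruled_surface F i u y) (at t within {0..T}) \<in> W)) \<longleftrightarrow>
        \<not> lin_indep [?a, ?b, ?c]" (is "?L \<longleftrightarrow> ?R")
      proof
        assume ?L
        then obtain W where W: "subspace W" "dim W = 2"
          and 1: "\<And>u. u \<in> ?I \<Longrightarrow> ?a \<in> W"
          and 2: "\<And>u. u \<in> ?I \<Longrightarrow> (1 + of_int i - u) *\<^sub>R ?b + (u - of_int i) *\<^sub>R ?c \<in> W"
          using ruled_surface_deriv_ruling[of _ i F t]
            ruled_surface_deriv_curve[of r T F i t, OF C assms(2,3) t] by auto
        have a: "?a \<in> W" using 1[of "of_int i"] by simp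
        have b: "?b \<in> W" using 2[of "of_int i"] by simp
        have h: "(1/2) *\<^sub>R ?b + (1/2) *\<^sub>R ?c \<in> W" using 2[of "of_int i + 1/2"] by simp
        have "2 *\<^sub>R ((1/2) *\<^sub>R ?b + (1/2) *\<^sub>R ?c) - ?b \<in> W"
          using W(1) h b by (intro subspace_diff subspace_scale)
        then have c: "?c \<in> W" by (simp add: scaleR_add_right)
        show ?R
        proof
          assume l: "lin_indep [?a, ?b, ?c]"
          have "card {?a, ?b, ?c} \<le> dim W"
            using l a b c by (intro independent_card_le_dim) (auto simp: lin_indep_def)
          moreover have "card {?a, ?b, ?c} = 3"
            using l by (auto simp: lin_indep_def)
          ultimately show False using W(2) by simp
        qed
      next
        assume r: ?R
        have c: "?c \<in> span {?a, ?b}"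
        proof (cases "?c = ?a \<or> ?c = ?b")
          case True
          then show ?thesis by (auto intro: span_base)
        next
          case False
          then have "dependent {?a, ?b, ?c}"
            using r ind by (auto simp: lin_indep_def)
          moreover have "{?a, ?b, ?c} = insert ?c {?a, ?b}" by auto
          ultimately show ?thesis
            using ind' False by (metis independent_insert)
        qed
        have d: "dim (span {?a, ?b}) = 2"
          using ind ind' by (simp add: dim_eq_card_independent)
        show ?L
        proof (intro exI conjI ballI)
          show "subspace (span {?a, ?b})" by simp
          show "dim (span {?a, ?b}) = 2" by (rule d)
          fix u assume u: "u \<in> ?I"
          show "vector_derivative (\<lambda>x. ruled_surface F i x t) (at u within ?I) \<in> span {?a, ?b}"
            unfolding ruled_surface_deriv_ruling[OF u] by (simp add: span_base)
          show "vector_derivative (\<lambda>y. ruled_surface F i u y) (at t within {0..T}) \<in> span {?a, ?b}"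
            unfolding ruled_surface_deriv_curve[of r T F i t, OF C assms(2,3) t]
            using c by (intro span_add span_scale) (simp_all add: span_base)
        qed
      qed
    qed
  qed
  then show ?thesis using assms(1) by (simp add: conjugate_surface_def)
qed

end

theory Submission
  imports Defs
begin

text \<open>
  Identify the affine function \<open>x \<mapsto> det (w, x) - c\<close> on \<open>R^2\<close> with its graph, a plane in \<open>R^3\<close> of slope
  \<open>w\<close>.  A surface over a regular planar \<open>f\<close> is conjugate iff, for every \<open>i\<close> and \<open>t\<close>, one such plane
  contains the ruling from \<open>F_i(t)\<close> to \<open>F_{i+1}(t)\<close> together with the tangents of both curves there.
  Call its slope \<open>W_i(t)\<close>.  The theorem comes from comparing neighbouring planes in the two
  directions.

  \<^item> The planes of the strips \<open>i - 1\<close> and \<open>i\<close> share the tangent of the curve \<open>F_i\<close>, so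
    \<open>W_i - W_{i-1} = \<lambda>_i f_i'\<close> for some number \<open>\<lambda>_i\<close>.
  \<^item> Infinitesimally close planes of one strip share the ruling, so \<open>W_i' = - \<mu>_i \<Delta>f_i\<close> for some
    number \<open>\<mu>_i\<close>.

  Differentiating the first relation and inserting the second gives
  \<open>(\<lambda>_i f_i')' = \<mu>_{i-1} \<Delta>f_{i-1} - \<mu>_i \<Delta>f_i\<close>, which is the equation of a self-stress.  This is the
  passage from conjugate surfaces to stresses: Cramer's rule gives \<open>W_i\<close> (\<open>plane_slope\<close>), and
  \<open>slope_step\<close> and \<open>slope_deriv\<close> compute \<open>\<lambda>\<close> and \<open>\<mu>\<close>, which turn out to be the stated functions.

  In the other direction the self-stress equation is the integrability condition that allows slopes
  \<open>V_k\<close> (playing the role of \<open>W_{k-1}\<close>) and constants \<open>c_k\<close> to be defined consistently: they jump by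
  \<open>\<lambda>_k f_k'\<close> and \<open>\<lambda>_k det (f_k', f_k)\<close> across the curve \<open>k\<close>, and change at the rates
  \<open>- \<mu>_{k-1} \<Delta>f_{k-1}\<close> and \<open>- \<mu>_{k-1} det (\<Delta>f_{k-1}, f_k)\<close> along a strip.  The
  summands of the height function, signs included, are exactly the increments of \<open>det (V_k, x) - c_k\<close> along the path,
  taken at the fixed point \<open>x = f(p)\<close>.  They telescope (\<open>height_eq\<close>), so the lifted
  height is \<open>z_k = det (V_k, f_k) - c_k\<close> whatever the path.  It follows that \<open>z_k' = det (V_k, f_k')\<close>
  and \<open>\<Delta>z_k = det (V_{k+1}, \<Delta>f_k)\<close>, so that \<open>\<Delta>L_k\<close>, \<open>L_k'\<close> and \<open>L_{k+1}'\<close> all lie in the graph of the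
  linear form \<open>det (V_{k+1}, _)\<close> and are linearly dependent.
\<close>

section \<open>Calculus of curves of class C^r\<close>

lemma at_within_Icc_neq_bot:
  fixes T t :: real
  assumes "0 < T" "t \<in> {0..T}"
  shows "at t within {0..T} \<noteq> bot"
  using assms by (simp add: trivial_limit_within islimpt_Icc)

lemma curve_deriv_eqI:
  assumes "0 < T" "t \<in> {0..T}" "(c has_vector_derivative c') (at t within {0..T})"
  shows "curve_deriv T c t = c'"
  unfolding curve_deriv_def
  by (rule vector_derivative_within[OF at_within_Icc_neq_bot[OF assms(1,2)] assms(3)])

lemma has_vector_derivative_cong_on:
  assumes "\<And>u. u \<in> S \<Longrightarrow> c u = d u" "t \<in> S"
  shows "(c has_vector_derivative v) (at t within S) \<longleftrightarrow> (d has_vector_derivative v) (at t within S)"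
  using assms has_vector_derivative_transform[of t S] by metis

lemma curve_deriv_cong:
  assumes "\<And>u. u \<in> {0..T} \<Longrightarrow> c u = d u" "t \<in> {0..T}"
  shows "curve_deriv T c t = curve_deriv T d t"
  unfolding curve_deriv_def vector_derivative_def
  using has_vector_derivative_cong_on[of "{0..T}" c d t, OF assms] by simp

lemma funpow_curve_deriv_cong:
  assumes "\<And>u. u \<in> {0..T} \<Longrightarrow> c u = d u" "t \<in> {0..T}"
  shows "(curve_deriv T ^^ k) c t = (curve_deriv T ^^ k) d t"
  using assms(2)
proof (induction k arbitrary: t)
  case 0
  then show ?case using assms(1) by simp
next
  case (Suc k)
  show ?case
    unfolding funpow.simps o_apply by (rule curve_deriv_cong[OF Suc.IH Suc.prems])
qed

lemma C_class_cong:
  assumes "\<And>u. u \<in> {0..T} \<Longrightarrow> c u = d u"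
  shows "C_class r T c \<longleftrightarrow> C_class r T d"
proof -
  have eq: "(curve_deriv T ^^ k) c t = (curve_deriv T ^^ k) d t" if "t \<in> {0..T}" for k t
    using funpow_curve_deriv_cong[of T c d] assms that by blast
  have "continuous_on {0..T} ((curve_deriv T ^^ k) c) \<longleftrightarrow>
        continuous_on {0..T} ((curve_deriv T ^^ k) d)" for k
    using eq by (intro continuous_on_cong) auto
  moreover have "(curve_deriv T ^^ k) c differentiable_on {0..T} \<longleftrightarrow>
        (curve_deriv T ^^ k) d differentiable_on {0..T}" for k
    unfolding differentiable_on_def
    using eq differentiable_transform_within[OF _ zero_less_one] by (metis (no_types, lifting))
  ultimately show ?thesis by (simp add: C_class_def)
qed

lemma C_class_0_iff: "C_class (enat 0) T c \<longleftrightarrow> continuous_on {0..T} c"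
  by (auto simp: C_class_def)

text \<open>Reduces every question about a class \<open>r\<close>, finite or not, to induction over finite classes.\<close>

lemma C_class_enat_iff: "C_class r T c \<longleftrightarrow> (\<forall>k. enat k \<le> r \<longrightarrow> C_class (enat k) T c)"
proof
  assume L: "C_class r T c"
  show "\<forall>k. enat k \<le> r \<longrightarrow> C_class (enat k) T c"
    using L unfolding C_class_def by (meson order.trans less_le_trans)
next
  assume R: "\<forall>k. enat k \<le> r \<longrightarrow> C_class (enat k) T c"
  show "C_class r T c"
    unfolding C_class_def
  proof (intro conjI allI impI)
    fix k assume "enat k \<le> r"
    then show "continuous_on {0..T} ((curve_deriv T ^^ k) c)"
      using R unfolding C_class_def by blast
  next
    fix k assume "enat k < r"
    then have "C_class (enat (Suc k)) T c"
      using R by (simp add: Suc_ile_eq)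
    then show "(curve_deriv T ^^ k) c differentiable_on {0..T}"
      unfolding C_class_def by simp
  qed
qed

lemma C_class_mono:
  assumes "C_class r T c" "s \<le> r"
  shows "C_class s T c"
  using assms C_class_enat_iff by (metis order.trans)

lemma C_class_continuous_on:
  assumes "C_class r T c"
  shows "continuous_on {0..T} c"
  using C_class_mono[OF assms, of "enat 0"] unfolding C_class_0_iff by (simp add: enat_0)

text \<open>
  The iterates in the definition of the class are peeled off from the inside, so that the statement
  for \<open>k\<close> can be used as an induction hypothesis for the derivative.  Any function that agrees with
  the derivative on \<open>[0,T]\<close> may serve as \<open>c'\<close>.
\<close>

lemma C_class_Suc_iff:
  assumes "0 < T"
  shows "C_class (enat (Suc k)) T c \<longleftrightarrow>
    (\<exists>c'. (\<forall>t\<in>{0..T}. (c has_vector_derivative c' t) (at t within {0..T})) \<and> C_class (enat k) T c')"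
    (is "?L \<longleftrightarrow> ?R")
proof
  assume L: ?L
  have "C_class (enat k) T (curve_deriv T c)"
    unfolding C_class_def
  proof (intro conjI allI impI)
    fix j assume "enat j \<le> enat k"
    then have "continuous_on {0..T} ((curve_deriv T ^^ Suc j) c)"
      using L unfolding C_class_def by (metis Suc_le_mono enat_ord_simps(1))
    then show "continuous_on {0..T} ((curve_deriv T ^^ j) (curve_deriv T c))"
      by (simp only: funpow_Suc_right o_apply)
  next
    fix j assume "enat j < enat k"
    then have "(curve_deriv T ^^ Suc j) c differentiable_on {0..T}"
      using L unfolding C_class_def by (metis Suc_less_eq enat_ord_simps(2))
    then show "(curve_deriv T ^^ j) (curve_deriv T c) differentiable_on {0..T}"
      by (simp only: funpow_Suc_right o_apply)
  qed
  moreover have "(1::enat) \<le> enat (Suc k)" by (simp add: one_enat_def)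
  ultimately show ?R using C_class_has_deriv[OF L] by blast
next
  assume ?R
  then obtain c' where d: "\<And>t. t \<in> {0..T} \<Longrightarrow> (c has_vector_derivative c' t) (at t within {0..T})"
    and c': "C_class (enat k) T c'" by blast
  have "curve_deriv T c t = c' t" if "t \<in> {0..T}" for t
    using curve_deriv_eqI[OF assms that d[OF that]] .
  then have C: "C_class (enat k) T (curve_deriv T c)"
    using c' C_class_cong by blast
  have diff: "c differentiable_on {0..T}"
    unfolding differentiable_on_def using d differentiableI_vector by blast
  show ?L
    unfolding C_class_def
  proof (intro conjI allI impI)
    fix j assume j: "enat j \<le> enat (Suc k)"
    show "continuous_on {0..T} ((curve_deriv T ^^ j) c)"
    proof (cases j)
      case 0
      then show ?thesis using diff by (simp add: differentiable_imp_continuous_on)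
    next
      case (Suc i)
      then have "continuous_on {0..T} ((curve_deriv T ^^ i) (curve_deriv T c))"
        using C j unfolding C_class_def by simp
      then show ?thesis unfolding Suc by (simp only: funpow_Suc_right o_apply)
    qed
  next
    fix j assume j: "enat j < enat (Suc k)"
    show "(curve_deriv T ^^ j) c differentiable_on {0..T}"
    proof (cases j)
      case 0
      then show ?thesis using diff by simp
    next
      case (Suc i)
      then have "(curve_deriv T ^^ i) (curve_deriv T c) differentiable_on {0..T}"
        using C j unfolding C_class_def by simp
      then show ?thesis unfolding Suc by (simp only: funpow_Suc_right o_apply)
    qed
  qed
qed

lemma C_class_enatI: "(\<And>k. enat k \<le> r \<Longrightarrow> C_class (enat k) T c) \<Longrightarrow> C_class r T c"
  using C_class_enat_iff by blast

lemma C_class_SucI: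
  assumes "0 < T" "\<And>t. t \<in> {0..T} \<Longrightarrow> (c has_vector_derivative c' t) (at t within {0..T})"
    and "C_class (enat k) T c'"
  shows "C_class (enat (Suc k)) T c"
  using assms(2,3) by (subst C_class_Suc_iff[OF assms(1)]) blast

lemma C_class_antiderivative:
  assumes "0 < T" "\<And>t. t \<in> {0..T} \<Longrightarrow> (c has_vector_derivative c' t) (at t within {0..T})"
    and "C_class s T c'" "r \<le> s + 1"
  shows "C_class r T c"
proof (rule C_class_enatI)
  fix k assume k: "enat k \<le> r"
  show "C_class (enat k) T c"
  proof (cases k)
    case 0
    then show ?thesis
      using continuous_on_vector_derivative[OF assms(2)] by (simp only: C_class_0_iff)
  next
    case (Suc j)
    have "enat (Suc j) \<le> s + 1" using k assms(4) Suc by auto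
    then have "enat j \<le> s" by (cases s) (auto simp: one_enat_def)
    then have c': "C_class (enat j) T c'" using assms(3) C_class_mono by blast
    show ?thesis
      unfolding Suc by (rule C_class_SucI[OF assms(1)]) (fact assms(2), fact c')
  qed
qed

lemma C_class_curve_deriv:
  assumes "0 < T" "C_class r T c" "s + 1 \<le> r"
  shows "C_class s T (curve_deriv T c)"
proof (rule C_class_enatI)
  fix k assume k: "enat k \<le> s"
  have "enat (Suc k) \<le> r"
    using k assms(3) by (cases s; cases r) (auto simp: one_enat_def)
  then have "C_class (enat (Suc k)) T c" using assms(2) C_class_mono by blast
  then obtain c' where d: "\<And>t. t \<in> {0..T} \<Longrightarrow> (c has_vector_derivative c' t) (at t within {0..T})"
    and c': "C_class (enat k) T c'" unfolding C_class_Suc_iff[OF assms(1)] by blast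
  have "curve_deriv T c t = c' t" if "t \<in> {0..T}" for t
    using curve_deriv_eqI[OF assms(1) that d[OF that]] .
  then show "C_class (enat k) T (curve_deriv T c)" using c' C_class_cong by blast
qed

lemma C_class_linear:
  assumes "0 < T" "bounded_linear h" "C_class r T c"
  shows "C_class r T (\<lambda>t. h (c t))"
proof -
  have "C_class (enat k) T (\<lambda>t. h (c t))" if "C_class (enat k) T c" for k c
    using that
  proof (induction k arbitrary: c)
    case 0
    then show ?case
      by (simp add: C_class_0_iff bounded_linear.continuous_on[OF assms(2)])
  next
    case (Suc k)
    then obtain c' where "\<forall>t\<in>{0..T}. (c has_vector_derivative c' t) (at t within {0..T})"
      "C_class (enat k) T c'" unfolding C_class_Suc_iff[OF assms(1)] by blast
    then show ?case
      by (intro C_class_SucI[OF assms(1) bounded_linear.has_vector_derivative[OF assms(2)]] Suc.IH) auto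
  qed
  then show ?thesis using C_class_mono[OF assms(3)] by (blast intro: C_class_enatI)
qed

lemma C_class_Pair:
  assumes "0 < T" "C_class r T a" "C_class r T b"
  shows "C_class r T (\<lambda>t. (a t, b t))"
proof -
  have "C_class (enat k) T (\<lambda>t. (a t, b t))" if "C_class (enat k) T a" "C_class (enat k) T b" for k a b
    using that
  proof (induction k arbitrary: a b)
    case 0
    then show ?case by (simp add: C_class_0_iff continuous_on_Pair)
  next
    case (Suc k)
    from Suc.prems obtain a' b'
      where "\<forall>t\<in>{0..T}. (a has_vector_derivative a' t) (at t within {0..T})"
        "\<forall>t\<in>{0..T}. (b has_vector_derivative b' t) (at t within {0..T})"
        "C_class (enat k) T a'" "C_class (enat k) T b'"
      unfolding C_class_Suc_iff[OF assms(1)] by blast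
    then show ?case
      by (intro C_class_SucI[OF assms(1) has_vector_derivative_Pair] Suc.IH) auto
  qed
  then show ?thesis
    using C_class_mono[OF assms(2)] C_class_mono[OF assms(3)] by (blast intro: C_class_enatI)
qed

lemma C_class_add:
  assumes "0 < T" "C_class r T a" "C_class r T b"
  shows "C_class r T (\<lambda>t. a t + b t)"
  using C_class_linear[OF assms(1) _ C_class_Pair[OF assms], of "\<lambda>p. fst p + snd p"]
  by (simp add: bounded_linear_add bounded_linear_fst bounded_linear_snd)

lemma C_class_diff:
  assumes "0 < T" "C_class r T a" "C_class r T b"
  shows "C_class r T (\<lambda>t. a t - b t)"
  using C_class_linear[OF assms(1) _ C_class_Pair[OF assms], of "\<lambda>p. fst p - snd p"]
  by (simp add: bounded_linear_sub bounded_linear_fst bounded_linear_snd)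

lemma C_class_bilinear:
  assumes "0 < T" "bounded_bilinear h" "C_class r T a" "C_class r T b"
  shows "C_class r T (\<lambda>t. h (a t) (b t))"
proof -
  have "C_class (enat k) T (\<lambda>t. h (a t) (b t))"
    if "C_class (enat k) T a" "C_class (enat k) T b" for k a b
    using that
  proof (induction k arbitrary: a b)
    case 0
    then show ?case
      by (simp add: C_class_0_iff bounded_bilinear.continuous_on[OF assms(2)])
  next
    case (Suc k)
    from Suc.prems obtain a' b'
      where d: "\<forall>t\<in>{0..T}. (a has_vector_derivative a' t) (at t within {0..T})"
        "\<forall>t\<in>{0..T}. (b has_vector_derivative b' t) (at t within {0..T})"
        and C: "C_class (enat k) T a'" "C_class (enat k) T b'"
      unfolding C_class_Suc_iff[OF assms(1)] by blast
    have "C_class (enat k) T a" "C_class (enat k) T b"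
      using Suc.prems C_class_mono by fastforce+
    then have "C_class (enat k) T (\<lambda>t. h (a t) (b' t) + h (a' t) (b t))"
      using Suc.IH C by (intro C_class_add assms(1)) auto
    then show ?case
      using d
      by (intro C_class_SucI[OF assms(1) bounded_bilinear.has_vector_derivative[OF assms(2)]]) auto
  qed
  then show ?thesis
    using C_class_mono[OF assms(3)] C_class_mono[OF assms(4)] by (blast intro: C_class_enatI)
qed

lemmas C_class_mult = C_class_bilinear[OF _ bounded_bilinear_mult]
lemmas C_class_scaleR = C_class_bilinear[OF _ bounded_bilinear_scaleR]

lemma C_class_inverse:
  fixes a :: "real \<Rightarrow> real"
  assumes "0 < T" "C_class r T a" "\<And>t. t \<in> {0..T} \<Longrightarrow> a t \<noteq> 0"
  shows "C_class r T (\<lambda>t. inverse (a t))"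
proof -
  have "C_class (enat k) T (\<lambda>t. inverse (a t))" if "C_class (enat k) T a" for k
    using that
  proof (induction k)
    case 0
    then show ?case using assms(3) by (simp add: C_class_0_iff continuous_on_inverse)
  next
    case (Suc k)
    from Suc.prems obtain a'
      where d: "\<forall>t\<in>{0..T}. (a has_vector_derivative a' t) (at t within {0..T})"
        and C: "C_class (enat k) T a'"
      unfolding C_class_Suc_iff[OF assms(1)] by blast
    have "C_class (enat k) T a"
      using Suc.prems C_class_mono by fastforce
    then have "C_class (enat k) T (\<lambda>t. inverse (a t))" by (rule Suc.IH)
    then have "C_class (enat k) T (\<lambda>t. - (inverse (a t) * a' t * inverse (a t)))"
      using C assms(1)
      by (intro C_class_linear[OF _ bounded_linear_minus[OF bounded_linear_ident]] C_class_mult)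
    moreover have "((\<lambda>t. inverse (a t)) has_vector_derivative - (inverse (a t) * a' t * inverse (a t)))
        (at t within {0..T})" if "t \<in> {0..T}" for t
      using d assms(3)[OF that] that
      by (auto simp: has_real_derivative_iff_has_vector_derivative[symmetric] intro!: DERIV_inverse')
    ultimately show ?case by (intro C_class_SucI[OF assms(1)])
  qed
  then show ?thesis using C_class_mono[OF assms(2)] by (blast intro: C_class_enatI)
qed

lemma C_class_divide:
  fixes a b :: "real \<Rightarrow> real"
  assumes "0 < T" "C_class r T a" "C_class r T b" "\<And>t. t \<in> {0..T} \<Longrightarrow> b t \<noteq> 0"
  shows "C_class r T (\<lambda>t. a t / b t)"
  unfolding divide_inverse using assms by (intro C_class_mult C_class_inverse)

lemma C_class_difference:
  assumes "0 < T" "C_class r T (F i)" "C_class r T (F (i + 1))"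
  shows "C_class r T (diff F i)"
  using C_class_diff[OF assms(1,3,2)] by (simp add: diff_def[abs_def])

section \<open>The planar determinant and linear independence\<close>

lemma bounded_bilinear_det2: "bounded_bilinear det2"
  unfolding bilinear_conv_bounded_bilinear[symmetric]
  by (auto simp: bilinear_def det2_eq algebra_simps intro!: linearI)

lemmas det2_bilinear_simps =
  bounded_bilinear.add_left[OF bounded_bilinear_det2]
  bounded_bilinear.add_right[OF bounded_bilinear_det2]
  bounded_bilinear.diff_left[OF bounded_bilinear_det2]
  bounded_bilinear.diff_right[OF bounded_bilinear_det2]
  bounded_bilinear.minus_left[OF bounded_bilinear_det2]
  bounded_bilinear.scaleR_left[OF bounded_bilinear_det2]
  bounded_bilinear.scaleR_right[OF bounded_bilinear_det2]

lemma det2_self [simp]: "det2 a a = 0"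
  by (simp add: det2_eq)

lemma det2_swap: "det2 b a = - det2 a b"
  by (simp add: det2_eq)

lemma eq_if_det2_eq:
  assumes "det2 a b \<noteq> 0" "det2 v a = det2 w a" "det2 v b = det2 w b"
  shows "v = w"
proof -
  have 1: "(v$1 - w$1) * a$2 = (v$2 - w$2) * a$1" "(v$1 - w$1) * b$2 = (v$2 - w$2) * b$1"
    using assms(2,3) by (simp_all add: det2_eq algebra_simps)
  have "(v$1 - w$1) * det2 a b = 0" "(v$2 - w$2) * det2 a b = 0"
    using 1 unfolding det2_eq by algebra+
  then show ?thesis using assms(1) by (simp add: vec_eq_iff forall_2)
qed

lemma lin_indep_commute: "lin_indep [a, b] \<longleftrightarrow> lin_indep [b, a]"
  by (auto simp: lin_indep_def insert_commute)

lemma lin_indep_imp_det2_nonzero: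
  assumes "lin_indep [a, b]"
  shows "det2 a b \<noteq> 0"
proof
  assume 0: "det2 a b = 0"
  have ab: "a \<noteq> b" "independent {a, b}" using assms by (auto simp: lin_indep_def)
  have b: "b \<noteq> 0" using ab(2) dependent_zero by blast
  have "a \<notin> span {b}"
    using ab by (simp add: independent_insert)
  moreover have "\<exists>x. a = x *\<^sub>R b"
  proof (cases "b$1 = 0")
    case True
    then have "b$2 \<noteq> 0" using b by (simp add: vec_eq_iff forall_2)
    then show ?thesis using 0 True
      by (intro exI[of _ "a$2 / b$2"]) (simp add: vec_eq_iff forall_2 det2_eq field_simps)
  next
    case False
    then show ?thesis using 0
      by (intro exI[of _ "a$1 / b$1"]) (simp add: vec_eq_iff forall_2 det2_eq field_simps)
  qed
  ultimately show False by (auto simp: span_singleton)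
qed

lemma lin_indep_lift:
  assumes "lin_indep [a, b]"
  shows "lin_indep [(a, x), (b, y)]"
proof -
  have ab: "a \<noteq> b" "independent {a, b}" using assms by (auto simp: lin_indep_def)
  then have "b \<noteq> 0" "a \<notin> span {b}"
    using dependent_zero[of "{a, b}"] by (auto simp: independent_insert)
  then have "(b, y) \<noteq> 0" "(a, x) \<notin> span {(b, y)}"
    by (auto simp: span_singleton zero_prod_def)
  then have "independent {(a, x), (b, y)}"
    by (simp add: independent_insert)
  then show ?thesis using ab by (auto simp: lin_indep_def)
qed

text \<open>The graph of a linear form on the plane is two-dimensional, so it has no three independent vectors.\<close>

lemma not_lin_indep_graph:
  fixes g :: "real^2 \<Rightarrow> real"
  assumes "linear g"
  shows "\<not> lin_indep [(a, g a), (b, g b), (c, g c)]"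
proof
  let ?g = "\<lambda>p. (p, g p)"
  assume l: "lin_indep [(a, g a), (b, g b), (c, g c)]"
  have lin: "linear ?g"
    using linear_add[OF assms] linear_scale[OF assms] by (intro linearI) auto
  have "card {?g a, ?g b, ?g c} \<le> dim (range ?g)"
    using l by (intro independent_card_le_dim) (auto simp: lin_indep_def)
  also have "\<dots> \<le> dim (UNIV :: (real^2) set)"
    by (rule dim_image_le[OF lin])
  also have "\<dots> = 2" by simp
  finally show False using l by (auto simp: lin_indep_def)
qed

text \<open>
  Extracts the equation of a plane from linear dependence: \<open>c\<close> lies in the span of \<open>a\<close> and \<open>b\<close>.
\<close>

lemma linear_vanishes_if_not_lin_indep:
  fixes h :: "'a::real_vector \<Rightarrow> real"
  assumes "linear h" "lin_indep [a, b]" "\<not> lin_indep [a, b, c]" "h a = 0" "h b = 0"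
  shows "h c = 0"
proof -
  have ab: "a \<noteq> b" "independent {a, b}" using assms(2) by (auto simp: lin_indep_def)
  have "c \<in> span {a, b}"
  proof (cases "c \<in> {a, b}")
    case True
    then show ?thesis by (rule span_base)
  next
    case False
    then have "\<not> independent {a, b, c}" using assms(3) ab by (auto simp: lin_indep_def)
    moreover have "{a, b, c} = insert c {a, b}" by auto
    ultimately show ?thesis using ab False by (metis independent_insert)
  qed
  then show ?thesis
    using linear_eq_0_on_span[OF assms(1), of "{a, b}" c] assms(4,5) by auto
qed

section \<open>From stresses to liftings\<close>

text \<open>
  In terms of statics, \<open>force\<close> is the resultant of the internal forces transmitted through a path
  from \<open>(0, 0)\<close> to \<open>(k, t)\<close>, and \<open>moment\<close> is its torque about the origin.  The definitions
  use the path that first runs along the strip \<open>-1\<close> up to time \<open>t\<close> and then crosses the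
  curves \<open>0, ..., k - 1\<close> at that time; then the jump across a curve is immediate, and the
  derivative in \<open>t\<close> follows by induction from equilibrium.
\<close>

definition force ::
    "real \<Rightarrow> (int \<Rightarrow> real \<Rightarrow> real^2) \<Rightarrow> (int \<Rightarrow> real \<Rightarrow> real) \<Rightarrow> (int \<Rightarrow> real \<Rightarrow> real) \<Rightarrow> int \<Rightarrow> real \<Rightarrow> real^2"
  where "force T f lam mu k t =
     (\<Sum>i = 0..k - 1. lam i t *\<^sub>R curve_deriv T (f i) t)
     - integral {0..t} (\<lambda>u. mu (-1) u *\<^sub>R diff f (-1) u)"

definition moment ::
    "real \<Rightarrow> (int \<Rightarrow> real \<Rightarrow> real^2) \<Rightarrow> (int \<Rightarrow> real \<Rightarrow> real) \<Rightarrow> (int \<Rightarrow> real \<Rightarrow> real) \<Rightarrow> int \<Rightarrow> real \<Rightarrow> real"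
  where "moment T f lam mu k t =
     (\<Sum>i = 0..k - 1. lam i t * det2 (curve_deriv T (f i) t) (f i t))
     - integral {0..t} (\<lambda>u. mu (-1) u * det2 (diff f (-1) u) (f (-1) u))"

lemma sum_upto_pred_int:
  fixes g :: "int \<Rightarrow> 'a::ab_group_add"
  assumes "0 \<le> k"
  shows "(\<Sum>i = 0..k. g i) = (\<Sum>i = 0..k - 1. g i) + g k"
proof -
  have "{0..k} = insert k {0..k - 1}" using assms by auto
  then show ?thesis by (simp add: add.commute)
qed

lemma force_step:
  assumes "0 \<le> k"
  shows "force T f lam mu (k + 1) t = force T f lam mu k t + lam k t *\<^sub>R curve_deriv T (f k) t"
  using sum_upto_pred_int[OF assms, of "\<lambda>i. lam i t *\<^sub>R curve_deriv T (f i) t"]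
  by (simp add: force_def)

lemma moment_step:
  assumes "0 \<le> k"
  shows "moment T f lam mu (k + 1) t =
    moment T f lam mu k t + lam k t * det2 (curve_deriv T (f k) t) (f k t)"
  using sum_upto_pred_int[OF assms, of "\<lambda>i. lam i t * det2 (curve_deriv T (f i) t) (f i t)"]
  by (simp add: moment_def)

locale self_stressed =
  fixes r :: enat and n :: nat and T :: real
    and f :: "int \<Rightarrow> real \<Rightarrow> real^2" and lam mu :: "int \<Rightarrow> real \<Rightarrow> real"
  assumes T: "0 < T" and r: "2 \<le> r"
    and framework: "framework r n T f"
    and self_stress: "self_stress n T f lam mu"
begin

abbreviation "f' i \<equiv> curve_deriv T (f i)"
abbreviation "f'' i \<equiv> curve_deriv T (f' i)"
abbreviation "V \<equiv> force T f lam mu"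
abbreviation "c \<equiv> moment T f lam mu"

lemma one_le_r: "1 \<le> r"
  using r by (rule order.trans[rotated]) simp

lemma f_C_class: "i \<in> {-1..int n + 1} \<Longrightarrow> C_class r T (f i)"
  using framework by (auto simp: framework_def semi_discrete_surface_def)

lemma f'_C_class:
  assumes "i \<in> {-1..int n + 1}"
  shows "C_class (r - 1) T (f' i)"
  using one_le_r by (intro C_class_curve_deriv[OF T f_C_class[OF assms]]) (cases r; auto simp: one_enat_def)

lemma f_deriv:
  "\<lbrakk>i \<in> {-1..int n + 1}; t \<in> {0..T}\<rbrakk> \<Longrightarrow> (f i has_vector_derivative f' i t) (at t within {0..T})"
  using C_class_has_deriv[OF f_C_class one_le_r] by blast

lemma f'_deriv:
  assumes "i \<in> {-1..int n + 1}" "t \<in> {0..T}"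
  shows "(f' i has_vector_derivative f'' i t) (at t within {0..T})"
proof (rule C_class_has_deriv[OF f'_C_class[OF assms(1)] _ assms(2)])
  show "1 \<le> r - 1" using r by (cases r) (auto simp: one_enat_def numeral_eq_enat)
qed

lemma diff_C_class: "i \<in> {-1..int n} \<Longrightarrow> C_class r T (diff f i)"
  by (intro C_class_difference T f_C_class) auto

lemma mu_continuous: "i \<in> {-1..int n} \<Longrightarrow> continuous_on {0..T} (mu i)"
  using self_stress by (auto simp: self_stress_def stress_def)

lemma lam_deriv:
  assumes "i \<in> {0..int n}" "t \<in> {0..T}"
  shows "(lam i has_vector_derivative curve_deriv T (lam i) t) (at t within {0..T})"
proof (rule C_class_has_deriv[OF _ _ assms(2)])
  show "C_class 1 T (lam i)"
    using self_stress assms(1) by (auto simp: self_stress_def stress_def)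
qed simp

lemma equilibrium:
  assumes "i \<in> {0..int n}" "t \<in> {0..T}"
  shows "curve_deriv T (lam i) t *\<^sub>R f' i t + lam i t *\<^sub>R f'' i t
    = mu (i - 1) t *\<^sub>R diff f (i - 1) t - mu i t *\<^sub>R diff f i t"
proof -
  have "curve_deriv T (lam i) t *\<^sub>R f' i t + lam i t *\<^sub>R f'' i t
    + mu i t *\<^sub>R diff f i t - mu (i - 1) t *\<^sub>R diff f (i - 1) t = 0"
    using self_stress assms by (auto simp: self_stress_def)
  then show ?thesis by (simp add: algebra_simps)
qed

text \<open>Equilibrium of the curve \<open>i\<close> in integrable form.\<close>

lemma tension_deriv:
  assumes "i \<in> {0..int n}" "t \<in> {0..T}"
  shows "((\<lambda>u. lam i u *\<^sub>R f' i u) has_vector_derivative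
    mu (i - 1) t *\<^sub>R diff f (i - 1) t - mu i t *\<^sub>R diff f i t) (at t within {0..T})"
proof -
  have "(f' i has_vector_derivative f'' i t) (at t within {0..T})"
    using f'_deriv assms by auto
  then have "((\<lambda>u. lam i u *\<^sub>R f' i u) has_vector_derivative
    lam i t *\<^sub>R f'' i t + curve_deriv T (lam i) t *\<^sub>R f' i t) (at t within {0..T})"
    by (rule bounded_bilinear.has_vector_derivative[OF bounded_bilinear_scaleR lam_deriv[OF assms]])
  then show ?thesis using equilibrium[OF assms] by (simp add: add.commute)
qed

text \<open>
  The tension \<open>lam k *\<^sub>R f' k\<close> added when the curve \<open>k\<close> is crossed changes at a rate that
  cancels the bars of the strip \<open>k - 1\<close> and brings in those of the strip \<open>k\<close>.
\<close>

lemma force_deriv: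
  assumes "k \<in> {0..int n + 1}" "t \<in> {0..T}"
  shows "(V k has_vector_derivative - (mu (k - 1) t *\<^sub>R diff f (k - 1) t)) (at t within {0..T})"
proof -
  have "0 \<le> k" using assms by simp
  then show ?thesis using assms(1)
  proof (induction k rule: int_ge_induct)
    case base
    have "continuous_on {0..T} (\<lambda>u. mu (-1) u *\<^sub>R diff f (-1) u)"
      by (intro continuous_on_scaleR mu_continuous C_class_continuous_on[OF diff_C_class]) auto
    then show ?case
      using has_vector_derivative_minus[OF integral_has_vector_derivative] assms(2)
      by (simp add: force_def[abs_def])
  next
    case (step k)
    have k: "k \<in> {0..int n}" using step by auto
    have "V (k + 1) = (\<lambda>u. V k u + lam k u *\<^sub>R f' k u)"
      using step by (simp add: force_step fun_eq_iff)
    moreover have "(V k has_vector_derivative - (mu (k - 1) t *\<^sub>R diff f (k - 1) t)) (at t within {0..T})"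
      using step.IH k by simp
    ultimately show ?case
      using has_vector_derivative_add[OF _ tension_deriv[OF k assms(2)]] by fastforce
  qed
qed

text \<open>
  The torque of a bar may be taken at either of its two ends, because \<open>det2 v\<close> takes the same value
  at points that differ by a multiple of \<open>v\<close>.  This moves the reference point from the curve \<open>k\<close>
  to the curve \<open>k + 1\<close> in the induction.
\<close>

lemma moment_deriv:
  assumes "k \<in> {0..int n + 1}" "t \<in> {0..T}"
  shows "(c k has_vector_derivative - (mu (k - 1) t * det2 (diff f (k - 1) t) (f k t)))
    (at t within {0..T})"
proof -
  have "0 \<le> k" using assms by simp
  then show ?thesis using assms(1)
  proof (induction k rule: int_ge_induct)
    case base
    have "continuous_on {0..T} (\<lambda>u. mu (-1) u * det2 (diff f (-1) u) (f (-1) u))"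
      by (intro continuous_on_mult mu_continuous bounded_bilinear.continuous_on[OF bounded_bilinear_det2]
          C_class_continuous_on[OF diff_C_class] C_class_continuous_on[OF f_C_class]) auto
    moreover have "det2 (diff f (-1) t) (f 0 t) = det2 (diff f (-1) t) (f (-1) t)"
      by (simp add: diff_def det2_eq algebra_simps)
    ultimately show ?case
      using has_vector_derivative_minus[OF integral_has_vector_derivative] assms(2)
      by (simp add: moment_def[abs_def])
  next
    case (step k)
    have k: "k \<in> {0..int n}" using step by auto
    have "(f k has_vector_derivative f' k t) (at t within {0..T})"
      using f_deriv k assms(2) by auto
    from bounded_bilinear.has_vector_derivative[OF bounded_bilinear_det2 tension_deriv[OF k assms(2)] this]
    have "((\<lambda>u. lam k u * det2 (f' k u) (f k u)) has_vector_derivative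
        mu (k - 1) t * det2 (diff f (k - 1) t) (f k t) - mu k t * det2 (diff f k t) (f k t))
        (at t within {0..T})"
      by (simp add: det2_bilinear_simps)
    moreover have "det2 (diff f k t) (f k t) = det2 (diff f k t) (f (k + 1) t)"
      by (simp add: diff_def det2_eq algebra_simps)
    moreover have "c (k + 1) = (\<lambda>u. c k u + lam k u * det2 (f' k u) (f k u))"
      using step by (simp add: moment_step fun_eq_iff)
    moreover have "(c k has_vector_derivative - (mu (k - 1) t * det2 (diff f (k - 1) t) (f k t)))
        (at t within {0..T})"
      using step.IH k by simp
    ultimately show ?case
      using has_vector_derivative_add by fastforce
  qed
qed

text \<open>
  The right-hand side does not contain the path: every summand of the height function is the
  increment, at the fixed point \<open>x = f k s\<close>, of the affine function \<open>\<Phi>\<close> over one leg of the path.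
\<close>

lemma height_eq:
  assumes "k \<in> {0..int n}" "s \<in> {0..T}" "increasing_path k s \<gamma>"
  shows "height T f lam mu \<gamma> k s = det2 (V k s) (f k s) - c k s"
proof -
  define x where "x = f k s"
  define \<Phi> where "\<Phi> i u = det2 (V i u) x - c i u" for i u
  have \<gamma>: "\<gamma> 0 = 0" "\<And>i. i \<in> {0..k} \<Longrightarrow> \<gamma> i \<le> \<gamma> (i + 1)" "\<gamma> (k + 1) = s"
    using assms(3) by (auto simp: increasing_path_def)
  have nonneg: "i \<le> k + 1 \<longrightarrow> 0 \<le> \<gamma> i" if "0 \<le> i" for i
    using that
  proof (induction i rule: int_ge_induct)
    case (step i)
    then show ?case using \<gamma>(2)[of i] by auto
  qed (simp add: \<gamma>)
  have le_s: "0 \<le> i \<longrightarrow> \<gamma> i \<le> s" if "i \<le> k + 1" for i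
    using that
  proof (induction i rule: int_le_induct)
    case (step i)
    then show ?case using \<gamma>(2)[of "i - 1"] by auto
  qed (simp add: \<gamma>)
  \<comment> \<open>a leg that crosses the curve \<open>i\<close> at time \<open>u\<close>\<close>
  have jump: "lam i u * det2 (f' i u) (x - f i u) = \<Phi> (i + 1) u - \<Phi> i u" if "0 \<le> i" for i u
    using that by (simp add: \<Phi>_def force_step moment_step det2_bilinear_simps right_diff_distrib)
  \<comment> \<open>a leg along the strip \<open>i - 1\<close>\<close>
  have slide: "integral {\<gamma> i..\<gamma> (i + 1)} (\<lambda>u. mu (i - 1) u * det2 (diff f (i - 1) u) (x - f (i - 1) u))
      = - (\<Phi> i (\<gamma> (i + 1)) - \<Phi> i (\<gamma> i))" if i: "i \<in> {0..k}" for i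
  proof -
    have sub: "{\<gamma> i..\<gamma> (i + 1)} \<subseteq> {0..T}"
      using nonneg[of i] le_s[of "i + 1"] i assms(2) by auto
    have "((\<lambda>u. - \<Phi> i u) has_vector_derivative mu (i - 1) u * det2 (diff f (i - 1) u) (x - f (i - 1) u))
        (at u within {\<gamma> i..\<gamma> (i + 1)})" if u: "u \<in> {\<gamma> i..\<gamma> (i + 1)}" for u
    proof (rule has_vector_derivative_within_subset[OF _ sub])
      have i': "i \<in> {0..int n + 1}" "u \<in> {0..T}" using i assms(1) u sub by auto
      have "((\<lambda>u. - \<Phi> i u) has_vector_derivative
          - (det2 (- (mu (i - 1) u *\<^sub>R diff f (i - 1) u)) x
             - - (mu (i - 1) u * det2 (diff f (i - 1) u) (f i u)))) (at u within {0..T})"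
        unfolding \<Phi>_def
        by (intro has_vector_derivative_minus has_vector_derivative_diff moment_deriv[OF i']
            bounded_linear.has_vector_derivative[OF
              bounded_bilinear.bounded_linear_left[OF bounded_bilinear_det2]] force_deriv[OF i'])
      moreover have "det2 (diff f (i - 1) u) (f i u) = det2 (diff f (i - 1) u) (f (i - 1) u)"
        by (simp add: diff_def det2_eq algebra_simps)
      ultimately show "((\<lambda>u. - \<Phi> i u) has_vector_derivative
          mu (i - 1) u * det2 (diff f (i - 1) u) (x - f (i - 1) u)) (at u within {0..T})"
        by (simp add: det2_bilinear_simps algebra_simps)
    qed
    from fundamental_theorem_of_calculus[OF _ this] \<gamma>(2)[OF i]
    show ?thesis by (simp add: integral_unique)
  qed
  have telescope: "(\<Sum>i = 0..j - 1. \<Phi> (i + 1) (\<gamma> (i + 1)) - \<Phi> i (\<gamma> (i + 1)))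
      + (\<Sum>i = 0..j. \<Phi> i (\<gamma> (i + 1)) - \<Phi> i (\<gamma> i)) = \<Phi> j (\<gamma> (j + 1)) - \<Phi> 0 (\<gamma> 0)"
    if "0 \<le> j" for j
    using that
  proof (induction j rule: int_ge_induct)
    case (step j)
    then show ?case
      using sum_upto_pred_int[of j "\<lambda>i. \<Phi> (i + 1) (\<gamma> (i + 1)) - \<Phi> i (\<gamma> (i + 1))"]
        sum_upto_pred_int[of "j + 1" "\<lambda>i. \<Phi> i (\<gamma> (i + 1)) - \<Phi> i (\<gamma> i)"] by simp
  qed simp
  have "height T f lam mu \<gamma> k s = \<Phi> k (\<gamma> (k + 1)) - \<Phi> 0 (\<gamma> 0)"
    unfolding height_def x_def[symmetric]
    using telescope[of k] assms(1) by (simp add: jump slide sum_subtractf)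
  also have "\<Phi> 0 (\<gamma> 0) = 0"
    by (simp add: \<gamma> \<Phi>_def force_def moment_def bounded_bilinear.zero_left[OF bounded_bilinear_det2])
  finally show ?thesis by (simp add: \<gamma> \<Phi>_def x_def)
qed

text \<open>
  The derivatives of \<open>V k\<close> and \<open>c k\<close> cancel at the point \<open>f k t\<close>: infinitesimally close planes
  intersect in the ruling through it.  Since no derivative of \<open>V k\<close> is left, the lifted height is,
  up to the class of \<open>f\<close>, of one class more than \<open>V k\<close> and hence of two more than \<open>mu\<close>.
\<close>

lemma lifted_height_deriv:
  assumes "k \<in> {0..int n}" "t \<in> {0..T}"
  shows "((\<lambda>u. det2 (V k u) (f k u) - c k u) has_vector_derivative det2 (V k t) (f' k t))
    (at t within {0..T})"
proof -
  have k: "k \<in> {0..int n + 1}" "k \<in> {-1..int n + 1}" using assms by auto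
  have "((\<lambda>u. det2 (V k u) (f k u) - c k u) has_vector_derivative
      det2 (V k t) (f' k t) + det2 (- (mu (k - 1) t *\<^sub>R diff f (k - 1) t)) (f k t)
      - - (mu (k - 1) t * det2 (diff f (k - 1) t) (f k t))) (at t within {0..T})"
    using assms(2) k
    by (intro has_vector_derivative_diff moment_deriv f_deriv force_deriv
        bounded_bilinear.has_vector_derivative[OF bounded_bilinear_det2])
  then show ?thesis by (simp add: det2_bilinear_simps)
qed

lemma force_C_class:
  assumes "k \<in> {0..int n + 1}" "C_class (r - 2) T (mu (k - 1))"
  shows "C_class (r - 1) T (V k)"
proof (rule C_class_antiderivative[OF T force_deriv[OF assms(1)]])
  have "C_class (r - 2) T (diff f (k - 1))"
    by (rule C_class_mono[OF diff_C_class]) (use assms(1) in auto)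
  then show "C_class (r - 2) T (\<lambda>t. - (mu (k - 1) t *\<^sub>R diff f (k - 1) t))"
    by (intro C_class_linear[OF T bounded_linear_minus[OF bounded_linear_ident]]
        C_class_scaleR[OF T assms(2)])
  show "r - 1 \<le> r - 2 + 1"
    using r by (cases r) (auto simp: one_enat_def numeral_eq_enat)
qed

lemma lifting_conjugate:
  assumes mu: "\<forall>i\<in>{-1..int n}. C_class (r - 2) T (mu i)"
    and L: "semi_discrete_lifting n T f lam mu L"
  shows "conjugate_surface r 0 (int n) T L"
proof -
  define z where "z k u = det2 (V k u) (f k u) - c k u" for k u
  have L: "L k u = (f k u, z k u)" if "k \<in> {0..int n}" "u \<in> {0..T}" for k u
    using L height_eq that unfolding semi_discrete_lifting_def z_def by metis
  have L': "curve_deriv T (L k) t = (f' k t, det2 (V k t) (f' k t))"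
    if k: "k \<in> {0..int n}" and t: "t \<in> {0..T}" for k t
  proof -
    have "((\<lambda>u. (f k u, z k u)) has_vector_derivative (f' k t, det2 (V k t) (f' k t)))
        (at t within {0..T})"
      unfolding z_def using k t by (intro has_vector_derivative_Pair f_deriv lifted_height_deriv) auto
    moreover have "curve_deriv T (L k) t = curve_deriv T (\<lambda>u. (f k u, z k u)) t"
      by (rule curve_deriv_cong) (use L k t in auto)
    ultimately show ?thesis using curve_deriv_eqI[OF T t] by metis
  qed
  \<comment> \<open>both planes along the curve \<open>k\<close> contain its tangent, so \<open>V k\<close> may be traded for \<open>V (k + 1)\<close>\<close>
  have tangent: "det2 (V (k + 1) t) (f' k t) = det2 (V k t) (f' k t)" if "k \<in> {0..int n}" for k t
    using that by (simp add: force_step det2_bilinear_simps)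
  have \<Delta>L: "diff L k t = (diff f k t, det2 (V (k + 1) t) (diff f k t))"
    if "k \<in> {0..<int n}" "t \<in> {0..T}" for k t
    using that L[of k t] L[of "k + 1" t]
    by (simp add: diff_def z_def force_step moment_step det2_bilinear_simps)
  have surface: "semi_discrete_surface r 0 (int n) T L"
    unfolding semi_discrete_surface_def
  proof (intro conjI ballI)
    fix k assume k: "k \<in> {0..int n}"
    have "C_class (r - 1) T (\<lambda>t. det2 (V k t) (f' k t))"
      using k mu by (intro C_class_bilinear[OF T bounded_bilinear_det2] force_C_class f'_C_class) auto
    then have "C_class r T (z k)"
    proof (rule C_class_antiderivative[OF T, rotated])
      show "(z k has_vector_derivative det2 (V k t) (f' k t)) (at t within {0..T})"
        if "t \<in> {0..T}" for t
        using lifted_height_deriv[OF k that] by (simp add: z_def[abs_def])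
      show "r \<le> r - 1 + 1"
        using r by (cases r) (auto simp: one_enat_def numeral_eq_enat)
    qed
    then have "C_class r T (\<lambda>t. (f k t, z k t))"
      using k by (intro C_class_Pair[OF T] f_C_class) auto
    then show "C_class r T (L k)"
      using C_class_cong[of T "L k" "\<lambda>t. (f k t, z k t)"] L[OF k] by blast
  next
    have reg: "regular (-1) (int n + 1) T f"
      using framework by (simp add: framework_def semi_discrete_surface_def)
    show "regular 0 (int n) T L"
      unfolding regular_def
    proof (intro ballI conjI impI)
      fix i t assume i: "i \<in> {0..int n}" and t: "t \<in> {0..T}"
      {
        assume "i < int n"
        then show "lin_indep [curve_deriv T (L i) t, diff L i t]"
          using reg i t by (simp add: L' \<Delta>L lin_indep_lift regular_def)
      }
      {
        assume "0 < i"
        then show "lin_indep [curve_deriv T (L i) t, diff L (i - 1) t]"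
          using reg i t by (simp add: L' \<Delta>L lin_indep_lift regular_def)
      }
    qed
  qed
  show ?thesis
    unfolding conjugate_surface_iff[OF surface one_le_r T]
  proof (intro ballI)
    fix i t assume i: "i \<in> {0..<int n}" and t: "t \<in> {0..T}"
    have "linear (det2 (V (i + 1) t))"
      using bounded_bilinear.bounded_linear_right[OF bounded_bilinear_det2] bounded_linear.linear by blast
    from not_lin_indep_graph[OF this, of "diff f i t" "f' i t" "f' (i + 1) t"]
    show "\<not> lin_indep [diff L i t, curve_deriv T (L i) t, curve_deriv T (L (i + 1)) t]"
      using i t tangent[of i t] by (simp add: L' \<Delta>L)
  qed
qed

end

section \<open>From conjugate surfaces to stresses\<close>

text \<open>
  Cramer's rule for the vector \<open>w\<close> with \<open>det2 w (diff f i t) = diff z i t\<close> and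
  \<open>det2 w (curve_deriv T (f i) t) = curve_deriv T (z i) t\<close>.
\<close>

definition plane_slope ::
    "real \<Rightarrow> (int \<Rightarrow> real \<Rightarrow> real^2) \<Rightarrow> (int \<Rightarrow> real \<Rightarrow> real) \<Rightarrow> int \<Rightarrow> real \<Rightarrow> real^2"
  where "plane_slope T f z i t =
     (1 / det2 (diff f i t) (curve_deriv T (f i) t)) *\<^sub>R
       (curve_deriv T (z i) t *\<^sub>R diff f i t - diff z i t *\<^sub>R curve_deriv T (f i) t)"

locale conjugate_over_regular =
  fixes r :: enat and n :: nat and T :: real
    and f :: "int \<Rightarrow> real \<Rightarrow> real^2" and z :: "int \<Rightarrow> real \<Rightarrow> real"
  assumes T: "0 < T" and r: "2 \<le> r"
    and conjugate: "conjugate_surface r (-1) (int n + 1) T (\<lambda>i t. (f i t, z i t))"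
    and regular: "regular (-1) (int n + 1) T f"
begin

abbreviation "f' i \<equiv> curve_deriv T (f i)"
abbreviation "f'' i \<equiv> curve_deriv T (f' i)"
abbreviation "z' i \<equiv> curve_deriv T (z i)"
abbreviation "z'' i \<equiv> curve_deriv T (z' i)"
abbreviation "W \<equiv> plane_slope T f z"
abbreviation "lam \<equiv> induced_lam T f z"
abbreviation "mu \<equiv> induced_mu T f z"

lemma one_le_r: "1 \<le> r"
  using r by (rule order.trans[rotated]) simp

lemma surface_C_class: "i \<in> {-1..int n + 1} \<Longrightarrow> C_class r T (\<lambda>t. (f i t, z i t))"
  using conjugate by (auto simp: conjugate_surface_def semi_discrete_surface_def)

lemma f_C_class: "i \<in> {-1..int n + 1} \<Longrightarrow> C_class r T (f i)"
  using C_class_linear[OF T bounded_linear_fst surface_C_class] by simp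

lemma z_C_class: "i \<in> {-1..int n + 1} \<Longrightarrow> C_class r T (z i)"
  using C_class_linear[OF T bounded_linear_snd surface_C_class] by simp

lemma C_class_curve_deriv_1: "C_class r T a \<Longrightarrow> C_class 1 T (curve_deriv T a)"
  by (rule C_class_curve_deriv[OF T]) (use r in \<open>simp_all add: one_add_one\<close>)

lemmas f'_C_1 = C_class_curve_deriv_1[OF f_C_class]
lemmas z'_C_1 = C_class_curve_deriv_1[OF z_C_class]

lemma C_1_if_C_r: "C_class r T a \<Longrightarrow> C_class 1 T a"
  by (rule C_class_mono[OF _ one_le_r])

lemma diff_f_C_1: "i \<in> {-1..int n} \<Longrightarrow> C_class 1 T (diff f i)"
  by (intro C_class_difference T C_1_if_C_r f_C_class) auto

lemma diff_z_C_1: "i \<in> {-1..int n} \<Longrightarrow> C_class 1 T (diff z i)"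
  by (intro C_class_difference T C_1_if_C_r z_C_class) auto

lemma has_deriv: "\<lbrakk>C_class 1 T a; t \<in> {0..T}\<rbrakk> \<Longrightarrow>
    (a has_vector_derivative curve_deriv T a t) (at t within {0..T})"
  by (rule C_class_has_deriv) auto

lemma det_next:
  assumes "i \<in> {-1..int n}" "t \<in> {0..T}"
  shows "det2 (diff f i t) (f' i t) \<noteq> 0"
  using lin_indep_imp_det2_nonzero[of "f' i t" "diff f i t"] regular assms det2_swap[of "f' i t"]
  by (auto simp: regular_def)

lemma det_prev:
  assumes "i \<in> {0..int n}" "t \<in> {0..T}"
  shows "det2 (diff f (i - 1) t) (f' i t) \<noteq> 0"
  using lin_indep_imp_det2_nonzero[of "f' i t" "diff f (i - 1) t"] regular assms det2_swap[of "f' i t"]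
  by (auto simp: regular_def)

lemma slope_ruling:
  assumes "i \<in> {-1..int n}" "t \<in> {0..T}"
  shows "det2 (W i t) (diff f i t) = diff z i t"
  using det_next[OF assms] det2_swap[of "f' i t" "diff f i t"]
  by (simp add: plane_slope_def det2_bilinear_simps)

lemma slope_tangent:
  assumes "i \<in> {-1..int n}" "t \<in> {0..T}"
  shows "det2 (W i t) (f' i t) = z' i t"
  using det_next[OF assms] by (simp add: plane_slope_def det2_bilinear_simps)

text \<open>
  This is where conjugacy enters: the plane through the ruling and the tangent at one end contains
  the tangent at the other end.
\<close>

lemma slope_tangent_next:
  assumes "i \<in> {-1..int n}" "t \<in> {0..T}"
  shows "det2 (W i t) (f' (i + 1) t) = z' (i + 1) t"
proof -
  let ?F = "\<lambda>i t. (f i t, z i t)"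
  have F': "curve_deriv T (?F j) t = (f' j t, z' j t)" if "j \<in> {-1..int n + 1}" for j
    using that
    by (intro curve_deriv_eqI[OF T assms(2)] has_vector_derivative_Pair has_deriv assms C_1_if_C_r f_C_class z_C_class)
  have \<Delta>F: "diff ?F i t = (diff f i t, diff z i t)" by (simp add: diff_def)
  define h where "h p = det2 (W i t) (fst p) - snd p" for p :: "(real^2) \<times> real"
  have "linear h"
    by (rule linearI) (simp_all add: h_def det2_bilinear_simps algebra_simps)
  moreover have "lin_indep [(diff f i t, diff z i t), (f' i t, z' i t)]"
  proof (rule lin_indep_lift)
    show "lin_indep [diff f i t, f' i t]"
      using regular assms by (simp add: regular_def lin_indep_commute[of "diff f i t"])
  qed
  moreover have "\<not> lin_indep [(diff f i t, diff z i t), (f' i t, z' i t), (f' (i + 1) t, z' (i + 1) t)]"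
  proof -
    have "semi_discrete_surface r (-1) (int n + 1) T ?F"
      using conjugate by (simp add: conjugate_surface_def)
    then show ?thesis
      using conjugate assms F'[of i] F'[of "i + 1"] \<Delta>F
        conjugate_surface_iff[of r "-1" "int n + 1" T ?F, OF _ one_le_r T] by force
  qed
  ultimately have "h (f' (i + 1) t, z' (i + 1) t) = 0"
    by (rule linear_vanishes_if_not_lin_indep)
      (simp_all add: h_def slope_ruling[OF assms] slope_tangent[OF assms])
  then show ?thesis by (simp add: h_def)
qed

text \<open>
  The planes on both sides of the curve \<open>i\<close> contain its tangent, so the difference of their slopes
  is parallel to \<open>f' i t\<close>; pairing it with \<open>diff f i t\<close> yields the factor.
\<close>

lemma slope_step:
  assumes i: "i \<in> {0..int n}" and t: "t \<in> {0..T}"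
  shows "W i t - W (i - 1) t = lam i t *\<^sub>R f' i t"
proof (rule eq_if_det2_eq[OF det_next])
  let ?a = "diff f (i - 1) t" and ?b = "diff f i t" and ?c = "f' i t"
  have prev: "det2 (W (i - 1) t) ?a = diff z (i - 1) t" "det2 (W (i - 1) t) ?c = z' i t"
    using slope_ruling[of "i - 1" t] slope_tangent_next[of "i - 1" t] i t by auto
  have self: "det2 (W i t) ?b = diff z i t" "det2 (W i t) ?c = z' i t"
    using i by (auto intro!: slope_ruling slope_tangent t)
  show "det2 (W i t - W (i - 1) t) ?c = det2 (lam i t *\<^sub>R ?c) ?c"
    by (simp add: det2_bilinear_simps prev self)
  have nz: "det2 ?a ?c \<noteq> 0" "det2 ?b ?c \<noteq> 0"
    using det_prev[OF i t] det_next[of i t] i t by auto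
  \<comment> \<open>Cramer's rule at the other end of the ruling: \<open>lam i t\<close> contains \<open>f' i t\<close> but not \<open>f' (i - 1) t\<close>\<close>
  have "W (i - 1) t = (1 / det2 ?a ?c) *\<^sub>R (z' i t *\<^sub>R ?a - diff z (i - 1) t *\<^sub>R ?c)"
    by (rule eq_if_det2_eq[OF nz(1)])
      (use nz prev det2_swap[of ?c ?a] in \<open>simp_all add: det2_bilinear_simps\<close>)
  then have "det2 (W (i - 1) t) ?b = (z' i t * det2 ?a ?b + diff z (i - 1) t * det2 ?b ?c) / det2 ?a ?c"
    by (simp add: det2_bilinear_simps det2_swap[of ?c ?b])
  then show "det2 (W i t - W (i - 1) t) ?b = det2 (lam i t *\<^sub>R ?c) ?b"
    using nz by (simp add: det2_bilinear_simps self det2_swap[of ?c ?b] induced_lam_def field_simps)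
qed (use i t in auto)

lemma slope_C_class:
  assumes "i \<in> {-1..int n}"
  shows "C_class 1 T (W i)"
  unfolding plane_slope_def[abs_def] divide_inverse mult_1 using assms det_next
  by (intro C_class_scaleR[OF T] C_class_diff[OF T] C_class_inverse[OF T]
      C_class_bilinear[OF T bounded_bilinear_det2] diff_f_C_1 diff_z_C_1 f'_C_1 z'_C_1) auto

text \<open>
  Differentiating \<open>slope_ruling\<close> shows that \<open>W'\<close> is parallel to the ruling, since by conjugacy the
  other terms cancel.  Differentiating \<open>slope_tangent\<close> yields the factor.
\<close>

lemma slope_deriv:
  assumes i: "i \<in> {-1..int n}" and t: "t \<in> {0..T}"
  shows "curve_deriv T (W i) t = - (mu i t *\<^sub>R diff f i t)"
proof (rule eq_if_det2_eq[OF det_next[OF i t]])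
  let ?W' = "curve_deriv T (W i) t"
  have i': "i \<in> {-1..int n + 1}" "i + 1 \<in> {-1..int n + 1}" using i by auto
  note W' = has_deriv[OF slope_C_class[OF i] t]
  have unique: "d = e" if "\<And>u. u \<in> {0..T} \<Longrightarrow> a u = b u"
      "(a has_vector_derivative d) (at t within {0..T})" "(b has_vector_derivative e) (at t within {0..T})"
    for a b :: "real \<Rightarrow> real" and d e
    using curve_deriv_eqI[OF T t that(2)] curve_deriv_eqI[OF T t that(3)]
      curve_deriv_cong[of T a b t, OF that(1) t] by simp
  have "det2 (W i t) (f' (i + 1) t - f' i t) + det2 ?W' (diff f i t) = z' (i + 1) t - z' i t"
  proof (rule unique)
    show "((\<lambda>u. det2 (W i u) (diff f i u)) has_vector_derivative
        det2 (W i t) (f' (i + 1) t - f' i t) + det2 ?W' (diff f i t)) (at t within {0..T})"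
      unfolding diff_def[abs_def]
      by (intro bounded_bilinear.has_vector_derivative[OF bounded_bilinear_det2 W']
          has_vector_derivative_diff has_deriv C_1_if_C_r f_C_class i' t)
    show "(diff z i has_vector_derivative z' (i + 1) t - z' i t) (at t within {0..T})"
      unfolding diff_def[abs_def] by (intro has_vector_derivative_diff has_deriv C_1_if_C_r z_C_class i' t)
  qed (rule slope_ruling[OF i])
  then show "det2 ?W' (diff f i t) = det2 (- (mu i t *\<^sub>R diff f i t)) (diff f i t)"
    by (simp add: det2_bilinear_simps slope_tangent[OF i t] slope_tangent_next[OF i t])
  have "det2 (W i t) (f'' i t) + det2 ?W' (f' i t) = z'' i t"
  proof (rule unique)
    show "((\<lambda>u. det2 (W i u) (f' i u)) has_vector_derivative
        det2 (W i t) (f'' i t) + det2 ?W' (f' i t)) (at t within {0..T})"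
      by (intro bounded_bilinear.has_vector_derivative[OF bounded_bilinear_det2 W'] has_deriv f'_C_1 i' t)
    show "(z' i has_vector_derivative z'' i t) (at t within {0..T})"
      by (intro has_deriv z'_C_1 i' t)
  qed (rule slope_tangent[OF i])
  then have "det2 ?W' (f' i t) = z'' i t -
      (z' i t * det2 (diff f i t) (f'' i t) - diff z i t * det2 (f' i t) (f'' i t))
        / det2 (diff f i t) (f' i t)"
    by (simp add: plane_slope_def det2_bilinear_simps)
  also have "\<dots> = - mu i t * det2 (diff f i t) (f' i t)"
    using det_next[OF i t] by (simp add: induced_mu_def power2_eq_square field_simps)
  finally show "det2 ?W' (f' i t) = det2 (- (mu i t *\<^sub>R diff f i t)) (f' i t)"
    by (simp add: det2_bilinear_simps)
qed

lemma induced_lam_C_class: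
  assumes "i \<in> {0..int n}"
  shows "C_class 1 T (lam i)"
  unfolding induced_lam_def[abs_def] using assms det_next det_prev
  by (intro C_class_add[OF T] C_class_diff[OF T] C_class_divide[OF T] C_class_mult[OF T]
      C_class_bilinear[OF T bounded_bilinear_det2] diff_f_C_1 diff_z_C_1 f'_C_1 z'_C_1) auto

lemma induced_mu_continuous:
  assumes i: "i \<in> {-1..int n}"
  shows "continuous_on {0..T} (mu i)"
proof -
  have i': "i \<in> {-1..int n + 1}" using i by auto
  have "continuous_on {0..T} (curve_deriv T a)" if "C_class 1 T a" for a :: "real \<Rightarrow> 'b::real_normed_vector"
    using that by (simp add: C_class_1_iff)
  note cont = this[OF f'_C_1[OF i']] this[OF z'_C_1[OF i']] f'_C_1[OF i', THEN C_class_continuous_on]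
    z'_C_1[OF i', THEN C_class_continuous_on]
    diff_f_C_1[OF i, THEN C_class_continuous_on] diff_z_C_1[OF i, THEN C_class_continuous_on]
  show ?thesis
    unfolding induced_mu_def[abs_def] using det_next[OF i]
    by (intro continuous_on_divide continuous_on_diff continuous_on_mult continuous_on_power cont
        bounded_bilinear.continuous_on[OF bounded_bilinear_det2]) auto
qed

lemma induced_self_stress: "self_stress n T f lam mu"
  unfolding self_stress_def stress_def
proof (intro conjI ballI)
  fix i t assume i: "i \<in> {0..int n}" and t: "t \<in> {0..T}"
  have i': "i \<in> {-1..int n + 1}" "i \<in> {-1..int n}" "i - 1 \<in> {-1..int n}" using i by auto
  have "curve_deriv T (\<lambda>u. lam i u *\<^sub>R f' i u) t = lam i t *\<^sub>R f'' i t + curve_deriv T (lam i) t *\<^sub>R f' i t"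
    by (intro curve_deriv_eqI[OF T t] bounded_bilinear.has_vector_derivative[OF bounded_bilinear_scaleR]
        has_deriv[OF induced_lam_C_class[OF i] t] has_deriv[OF f'_C_1[OF i'(1)] t])
  moreover have "curve_deriv T (\<lambda>u. lam i u *\<^sub>R f' i u) t = curve_deriv T (\<lambda>u. W i u - W (i - 1) u) t"
    by (rule curve_deriv_cong) (use slope_step[OF i] t in auto)
  moreover have "curve_deriv T (\<lambda>u. W i u - W (i - 1) u) t = curve_deriv T (W i) t - curve_deriv T (W (i - 1)) t"
    by (intro curve_deriv_eqI[OF T t] has_vector_derivative_diff has_deriv slope_C_class t i')
  ultimately have "lam i t *\<^sub>R f'' i t + curve_deriv T (lam i) t *\<^sub>R f' i t
      = mu (i - 1) t *\<^sub>R diff f (i - 1) t - mu i t *\<^sub>R diff f i t"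
    by (simp add: slope_deriv[OF i'(2) t] slope_deriv[OF i'(3) t])
  then show "curve_deriv T (lam i) t *\<^sub>R f' i t + lam i t *\<^sub>R f'' i t
      + mu i t *\<^sub>R diff f i t - mu (i - 1) t *\<^sub>R diff f (i - 1) t = 0"
    by (simp add: algebra_simps)
qed (simp_all add: induced_lam_C_class induced_mu_continuous)

lemma framework: "framework r n T f"
  using f_C_class regular by (simp add: framework_def semi_discrete_surface_def)

end

section \<open>The correspondence\<close>

theorem theorem3p8:
  fixes n :: nat and T :: real and r :: enat
  assumes "0 < T" and "2 \<le> r"
  shows
    "(\<forall>f lam mu L.
        framework r n T f \<longrightarrow>
        self_stress n T f lam mu \<longrightarrow>
        (\<forall>i\<in>{0..int n}. C_class (r - 1) T (lam i)) \<longrightarrow>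
        (\<forall>i\<in>{-1..int n}. C_class (r - 2) T (mu i)) \<longrightarrow>
        semi_discrete_lifting n T f lam mu L \<longrightarrow>
        conjugate_surface r 0 (int n) T L)
     \<and>
     (\<forall>f z.
        conjugate_surface r (-1) (int n + 1) T (\<lambda>i t. (f i t, z i t)) \<longrightarrow>
        regular (-1) (int n + 1) T f \<longrightarrow>
        framework r n T f \<and> stressable n T f \<and>
        self_stress n T f (induced_lam T f z) (induced_mu T f z))"
proof (intro conjI allI impI)
  fix f :: "int \<Rightarrow> real \<Rightarrow> real^2" and lam mu L
  assume "framework r n T f" "self_stress n T f lam mu"
    and *: "\<forall>i\<in>{-1..int n}. C_class (r - 2) T (mu i)" "semi_discrete_lifting n T f lam mu L"
  then interpret self_stressed r n T f lam mu
    using assms by unfold_locales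
  show "conjugate_surface r 0 (int n) T L"
    using * by (rule lifting_conjugate)
next
  fix f :: "int \<Rightarrow> real \<Rightarrow> real^2" and z :: "int \<Rightarrow> real \<Rightarrow> real"
  assume "conjugate_surface r (-1) (int n + 1) T (\<lambda>i t. (f i t, z i t))"
    "regular (-1) (int n + 1) T f"
  then interpret conjugate_over_regular r n T f z
    using assms by unfold_locales
  show "framework r n T f" by (rule framework)
  show "self_stress n T f (induced_lam T f z) (induced_mu T f z)"
    by (rule induced_self_stress)
  then show "stressable n T f" by (auto simp: stressable_def)
qed

end
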